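(* Let $R$ be the root system of type $C_2$ and let $q\in\mathbb{C}^\times$ be such that $q^2$ is not a primitive $\ell$-th root of unity for any $\ell\leq4$. If $t\in T_Q$ and $P(t)\cup Z(t)\neq\emptyset$, then $t$ is in the $W_0$-orbit of one of the following weights: $$t_{1,1},\ t_{-1,1},\ t_{1,q^2},\ t_{q^2,1},\ t_{q,1},\ t_{-q,1},\ t_{q^2,q^2},\ t_{-1,q^2};$$ $t_{1,z}$ with $z\in\mathbb{C}^\times$, $z\neq1,q^{\pm2}$; $t_{z,1}$ with $z\in\mathbb{C}^\times$, $z\neq\pm1,q^{\pm2},\pm q^{\pm1}$; $t_{q^2,z}$ with $z\in\mathbb{C}^\times$, $z\neq1,q^{\pm2},q^{-4},q^{-6}$; or $t_{z,q^2}$ with $z\in\mathbb{C}^\times$, $z\neq\pm1,q^{\pm2},-q^{-2},q^{-4},\pm q^{-1}$.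
   Context: The type $C_2$ root system has simple roots $\alpha_1,\alpha_2$ with $\langle\alpha_1,\alpha_2^\vee\rangle=-1$, $\langle\alpha_2,\alpha_1^\vee\rangle=-2$, positive roots $R^+=\{\alpha_1,\alpha_2,\alpha_1+\alpha_2,2\alpha_1+\alpha_2\}$, and Weyl group $W_0=\langle s_1,s_2\rangle$, $s_i\lambda=\lambda-\langle\lambda,\alpha_i^\vee\rangle\alpha_i$ (dihedral of order $8$). $Q=\mathbb{Z}\alpha_1+\mathbb{Z}\alpha_2$ is the root lattice, $\mathbb{C}[Q]$ is the group algebra with basis $X^\lambda$, $\lambda\in Q$, $X^\lambda X^\mu=X^{\lambda+\mu}$, and $T_Q=\mathrm{Hom}_{\mathbb{C}\text{-alg}}(\mathbb{C}[Q],\mathbb{C})$. $W_0$ acts on $T_Q$ by $(wt)(X^\lambda)=t(X^{w^{-1}\lambda})$. For $z,w\in\mathbb{C}^\times$, $t_{z,w}\in T_Q$ is defined by $t_{z,w}(X^{\alpha_1})=z$, $t_{z,w}(X^{\alpha_2})=w$. For $t\in T_Q$, $Z(t)=\{\alpha\in R^+\mid t(X^\alpha)=1\}$ and $P(t)=\{\alpha\in R^+\mid t(X^\alpha)\in\{q^2,q^{-2}\}\}$. *)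

theory Defs
  imports Complex_Main "HOL-Library.Poly_Mapping" "HOL-Library.Product_Plus"
    "HOL-Algebra.Bij" "HOL-Algebra.Generated_Groups"
begin

section \<open>The root system of type \<open>C\<^sub>2\<close>\<close>

text \<open>
  The root lattice \<open>Q = \<int>\<alpha>\<^sub>1 + \<int>\<alpha>\<^sub>2\<close> is free on the simple roots; \<open>(a, b)\<close> stands for
  \<open>a\<alpha>\<^sub>1 + b\<alpha>\<^sub>2\<close>. Its group structure is the componentwise one.
\<close>

type_synonym root_lattice = "int \<times> int"

definition \<alpha>1 :: root_lattice where "\<alpha>1 = (1, 0)"

definition \<alpha>2 :: root_lattice where "\<alpha>2 = (0, 1)"

definition pos_roots :: "root_lattice set" where
  "pos_roots = {\<alpha>1, \<alpha>2, \<alpha>1 + \<alpha>2, \<alpha>1 + \<alpha>1 + \<alpha>2}"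

text \<open>
  The pairings \<open>\<nu> \<mapsto> \<langle>\<nu>, \<alpha>\<^sub>1\<^sup>\<or>\<rangle>\<close> and \<open>\<nu> \<mapsto> \<langle>\<nu>, \<alpha>\<^sub>2\<^sup>\<or>\<rangle>\<close> are the linear forms with
  \<open>\<langle>\<alpha>\<^sub>i, \<alpha>\<^sub>i\<^sup>\<or>\<rangle> = 2\<close>, \<open>\<langle>\<alpha>\<^sub>1, \<alpha>\<^sub>2\<^sup>\<or>\<rangle> = -1\<close> and \<open>\<langle>\<alpha>\<^sub>2, \<alpha>\<^sub>1\<^sup>\<or>\<rangle> = -2\<close>.
\<close>

definition pair_coroot1 :: "root_lattice \<Rightarrow> int" where
  "pair_coroot1 = (\<lambda>(a, b). 2 * a - 2 * b)"

definition pair_coroot2 :: "root_lattice \<Rightarrow> int" where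
  "pair_coroot2 = (\<lambda>(a, b). 2 * b - a)"

definition int_scale :: "int \<Rightarrow> root_lattice \<Rightarrow> root_lattice" where
  "int_scale n = (\<lambda>(a, b). (n * a, n * b))"

definition s1 :: "root_lattice \<Rightarrow> root_lattice" where
  "s1 \<nu> = \<nu> - int_scale (pair_coroot1 \<nu>) \<alpha>1"

definition s2 :: "root_lattice \<Rightarrow> root_lattice" where
  "s2 \<nu> = \<nu> - int_scale (pair_coroot2 \<nu>) \<alpha>2"

definition W0 :: "(root_lattice \<Rightarrow> root_lattice) set" where
  "W0 = generate (BijGroup UNIV) {s1, s2}"


section \<open>The group algebra of the root lattice and its characters\<close>

text \<open>
  Finitely supported functions on \<open>Q\<close>; the multiplication of \<^theory>\<open>HOL-Library.Poly_Mapping\<close>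
  is convolution, so this is the group algebra \<open>\<complex>[Q]\<close>.
\<close>

type_synonym group_algebra = "root_lattice \<Rightarrow>\<^sub>0 complex"

definition X :: "root_lattice \<Rightarrow> group_algebra" where
  "X \<nu> = Poly_Mapping.single \<nu> 1"

definition T_Q :: "(group_algebra \<Rightarrow> complex) set" where
  "T_Q = {t. t 1 = 1 \<and>
             (\<forall>f g. t (f + g) = t f + t g) \<and>
             (\<forall>f g. t (f * g) = t f * t g) \<and>
             (\<forall>c f. t (Poly_Mapping.map ((*) c) f) = c * t f)}"

definition lin_ext :: "(root_lattice \<Rightarrow> complex) \<Rightarrow> group_algebra \<Rightarrow> complex" where
  "lin_ext \<chi> f = (\<Sum>\<nu>\<in>Poly_Mapping.keys f. Poly_Mapping.lookup f \<nu> * \<chi> \<nu>)"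

text \<open>
  The weight \<open>t\<^bsub>z,w\<^esub>\<close>, for \<open>z, w \<noteq> 0\<close>. See \<open>weight_in_T_Q\<close>, \<open>weight_X\<close> and \<open>T_Q_eqI\<close> below: it
  is the only element of \<open>T\<^sub>Q\<close> that takes the values \<open>z\<close> and \<open>w\<close> at the simple roots.
\<close>

definition weight :: "complex \<Rightarrow> complex \<Rightarrow> group_algebra \<Rightarrow> complex" where
  "weight z w = lin_ext (\<lambda>(a, b). z powi a * w powi b)"

text \<open>
  The action of \<open>W\<^sub>0\<close> on \<open>T\<^sub>Q\<close> is prescribed on the basis, \<open>(wt)(X\<^sup>\<nu>) = t(X\<^bsup>w\<inverse>\<nu>\<^esup>)\<close>, and
  extended linearly; see \<open>act_X\<close> and \<open>act_in_T_Q\<close>.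
\<close>

definition act :: "(root_lattice \<Rightarrow> root_lattice) \<Rightarrow> (group_algebra \<Rightarrow> complex) \<Rightarrow>
    group_algebra \<Rightarrow> complex" where
  "act w t = lin_ext (\<lambda>\<nu>. t (X (inv_into UNIV w \<nu>)))"

definition W0_orbit :: "(group_algebra \<Rightarrow> complex) \<Rightarrow> (group_algebra \<Rightarrow> complex) set" where
  "W0_orbit t = {act w t | w. w \<in> W0}"

definition Z_roots :: "(group_algebra \<Rightarrow> complex) \<Rightarrow> root_lattice set" where
  "Z_roots t = {\<alpha> \<in> pos_roots. t (X \<alpha>) = 1}"

definition P_roots :: "complex \<Rightarrow> (group_algebra \<Rightarrow> complex) \<Rightarrow> root_lattice set" where
  "P_roots q t = {\<alpha> \<in> pos_roots. t (X \<alpha>) \<in> {q\<^sup>2, q powi (-2)}}"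

definition primitive_root_of_unity :: "nat \<Rightarrow> complex \<Rightarrow> bool" where
  "primitive_root_of_unity l x \<longleftrightarrow> l > 0 \<and> x ^ l = 1 \<and> (\<forall>k. 0 < k \<and> k < l \<longrightarrow> x ^ k \<noteq> 1)"


section \<open>The definitions behave as intended\<close>

lemma cartan_integers:
  "pair_coroot1 \<alpha>1 = 2" "pair_coroot1 \<alpha>2 = -2" "pair_coroot2 \<alpha>1 = -1" "pair_coroot2 \<alpha>2 = 2"
  by (simp_all add: pair_coroot1_def pair_coroot2_def \<alpha>1_def \<alpha>2_def)

lemma s1_apply: "s1 (a, b) = (2 * b - a, b)"
  by (simp add: s1_def pair_coroot1_def int_scale_def \<alpha>1_def)

lemma s2_apply: "s2 (a, b) = (a, a - b)"
  by (simp add: s2_def pair_coroot2_def int_scale_def \<alpha>2_def)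

lemma s1_s1 [simp]: "s1 (s1 \<nu>) = \<nu>"
  by (cases \<nu>) (simp add: s1_apply)

lemma s2_s2 [simp]: "s2 (s2 \<nu>) = \<nu>"
  by (cases \<nu>) (simp add: s2_apply)

lemma s_in_BijGroup: "s1 \<in> carrier (BijGroup UNIV)" "s2 \<in> carrier (BijGroup UNIV)"
  by (simp_all add: BijGroup_def Bij_def involuntory_imp_bij)

lemma mult_BijGroup_UNIV:
  assumes "f \<in> carrier (BijGroup UNIV)" "g \<in> carrier (BijGroup UNIV)"
  shows "f \<otimes>\<^bsub>BijGroup UNIV\<^esub> g = f \<circ> g"
  using assms by (simp add: BijGroup_def compose_def fun_eq_iff)

lemma inv_BijGroup_UNIV:
  assumes "f \<in> carrier (BijGroup UNIV)"
  shows "inv\<^bsub>BijGroup UNIV\<^esub> f = inv_into UNIV f"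
  using inv_BijGroup[of f UNIV] assms by (simp add: BijGroup_def restrict_UNIV)

lemma W0_in_BijGroup: "w \<in> W0 \<Longrightarrow> w \<in> carrier (BijGroup UNIV)"
  using group.generate_in_carrier[OF group_BijGroup, of "{s1, s2}" UNIV w] s_in_BijGroup
  by (simp add: W0_def)

lemma W0_bij: "w \<in> W0 \<Longrightarrow> bij w"
  using W0_in_BijGroup[of w] by (simp add: BijGroup_def Bij_def)

lemma W0_add: "w \<in> W0 \<Longrightarrow> w (\<nu> + \<mu>) = w \<nu> + w \<mu>"
  unfolding W0_def
proof (induction w arbitrary: \<nu> \<mu> rule: generate.induct)
  case one
  show ?case by (simp add: BijGroup_def)
next
  case (incl h)
  then show ?case by (cases \<nu>; cases \<mu>) (auto simp: s1_apply s2_apply)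
next
  case (inv h)
  have "inv_into UNIV s1 = s1" "inv_into UNIV s2 = s2"
    by (rule inv_equality; simp)+
  with inv have "inv\<^bsub>BijGroup UNIV\<^esub> h = h"
    using s_in_BijGroup by (auto simp: inv_BijGroup_UNIV)
  with inv show ?case by (cases \<nu>; cases \<mu>) (auto simp: s1_apply s2_apply)
next
  case (eng h1 h2)
  then have "h1 \<otimes>\<^bsub>BijGroup UNIV\<^esub> h2 = h1 \<circ> h2"
    by (intro mult_BijGroup_UNIV W0_in_BijGroup) (simp_all add: W0_def)
  with eng show ?case by simp
qed

lemma X_add: "X (\<nu> + \<mu>) = X \<nu> * X \<mu>"
  by (simp add: X_def mult_single)

lemma X_zero: "X 0 = 1"
  by (simp add: X_def)

lemma lin_ext_X [simp]: "lin_ext \<chi> (X \<nu>) = \<chi> \<nu>"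
  by (simp add: lin_ext_def X_def)

lemma lin_ext_superset:
  assumes "finite A" "Poly_Mapping.keys f \<subseteq> A"
  shows "lin_ext \<chi> f = (\<Sum>\<nu>\<in>A. Poly_Mapping.lookup f \<nu> * \<chi> \<nu>)"
  unfolding lin_ext_def using assms by (intro sum.mono_neutral_left) (auto simp: in_keys_iff)

lemma lin_ext_add: "lin_ext \<chi> (f + g) = lin_ext \<chi> f + lin_ext \<chi> g"
proof -
  let ?A = "Poly_Mapping.keys f \<union> Poly_Mapping.keys g"
  have "Poly_Mapping.keys (f + g) \<subseteq> ?A" by (rule keys_add)
  then show ?thesis
    by (simp add: lin_ext_superset[of ?A] lookup_add algebra_simps sum.distrib)
qed

lemma lin_ext_zero [simp]: "lin_ext \<chi> 0 = 0"
  by (simp add: lin_ext_def)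

lemma lin_ext_single [simp]: "lin_ext \<chi> (Poly_Mapping.single \<nu> c) = c * \<chi> \<nu>"
  by (simp add: lin_ext_def)

lemma group_algebra_induct [case_names zero single add]:
  fixes f :: group_algebra
  assumes "P 0" "\<And>\<nu> c. P (Poly_Mapping.single \<nu> c)" "\<And>f g. P f \<Longrightarrow> P g \<Longrightarrow> P (f + g)"
  shows "P f"
proof (induction f rule: update_induct)
  case const
  show ?case by (rule assms)
next
  case (update f a b)
  have "Poly_Mapping.update a b f = f + Poly_Mapping.single a b"
    using update by (intro poly_mapping_eqI)
      (auto simp: lookup_update lookup_add lookup_single in_keys_iff when_def)
  then show ?case using assms update by simp
qed

lemma lin_ext_in_T_Q:
  assumes "\<chi> 0 = 1" "\<And>\<nu> \<mu>. \<chi> (\<nu> + \<mu>) = \<chi> \<nu> * \<chi> \<mu>"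
  shows "lin_ext \<chi> \<in> T_Q"
proof -
  have single: "lin_ext \<chi> (Poly_Mapping.single \<nu> c * g) = c * \<chi> \<nu> * lin_ext \<chi> g" for \<nu> c g
    by (induction g rule: group_algebra_induct)
      (simp_all add: mult_single assms lin_ext_add distrib_left)
  have "lin_ext \<chi> (f * g) = lin_ext \<chi> f * lin_ext \<chi> g" for f g
    by (induction f rule: group_algebra_induct)
      (simp_all add: single lin_ext_add distrib_right)
  moreover have "lin_ext \<chi> 1 = 1"
    using lin_ext_X[of \<chi> 0] assms by (simp add: X_zero)
  ultimately show ?thesis
    by (simp add: T_Q_def lin_ext_add mult_map_scale_conv_mult single assms)
qed

lemma T_Q_eq_lin_ext: "t \<in> T_Q \<Longrightarrow> t f = lin_ext (\<lambda>\<nu>. t (X \<nu>)) f"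
proof (induction f rule: group_algebra_induct)
  case zero
  then have "t (0 + 0) = t 0 + t 0" unfolding T_Q_def by blast
  then show ?case by simp
next
  case (single \<nu> c)
  then have "t (Poly_Mapping.map ((*) c) (X \<nu>)) = c * t (X \<nu>)" unfolding T_Q_def by blast
  then show ?case by (simp add: X_def mult_map_scale_conv_mult mult_single)
next
  case (add f g)
  then show ?case by (simp add: T_Q_def lin_ext_add)
qed

lemma weight_in_T_Q: "z \<noteq> 0 \<Longrightarrow> w \<noteq> 0 \<Longrightarrow> weight z w \<in> T_Q"
  unfolding weight_def
  by (rule lin_ext_in_T_Q) (auto simp: zero_prod_def power_int_add)

lemma weight_X: "weight z w (X \<alpha>1) = z" "weight z w (X \<alpha>2) = w"
  by (simp_all add: weight_def \<alpha>1_def \<alpha>2_def)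

lemma T_Q_X:
  assumes "t \<in> T_Q"
  shows "t (X \<alpha>1) \<noteq> 0" "t (X \<alpha>2) \<noteq> 0"
    and "t (X (a, b)) = t (X \<alpha>1) powi a * t (X \<alpha>2) powi b"
proof -
  have mult: "t (X (\<nu> + \<mu>)) = t (X \<nu>) * t (X \<mu>)" for \<nu> \<mu>
    using assms by (simp add: T_Q_def X_add)
  have one: "t (X 0) = 1"
    using assms by (simp add: T_Q_def X_zero)
  have nz: "t (X \<nu>) \<noteq> 0" for \<nu>
    using mult[of \<nu> "- \<nu>"] one by auto
  have fst: "t (X (a, 0)) = t (X \<alpha>1) powi a" for a
  proof (induction a rule: int_induct[where k = 0])
    case base
    show ?case using one by (simp add: zero_prod_def)
  next
    case (step1 i)
    then show ?case using mult[of "(i, 0)" \<alpha>1] nz[of \<alpha>1] by (simp add: \<alpha>1_def power_int_add)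
  next
    case (step2 i)
    then show ?case using mult[of "(i - 1, 0)" \<alpha>1] nz[of \<alpha>1]
      by (simp add: \<alpha>1_def power_int_diff field_simps)
  qed
  have snd: "t (X (0, b)) = t (X \<alpha>2) powi b" for b
  proof (induction b rule: int_induct[where k = 0])
    case base
    show ?case using one by (simp add: zero_prod_def)
  next
    case (step1 i)
    then show ?case using mult[of "(0, i)" \<alpha>2] nz[of \<alpha>2] by (simp add: \<alpha>2_def power_int_add)
  next
    case (step2 i)
    then show ?case using mult[of "(0, i - 1)" \<alpha>2] nz[of \<alpha>2]
      by (simp add: \<alpha>2_def power_int_diff field_simps)
  qed
  show "t (X \<alpha>1) \<noteq> 0" "t (X \<alpha>2) \<noteq> 0" by (rule nz)+
  show "t (X (a, b)) = t (X \<alpha>1) powi a * t (X \<alpha>2) powi b"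
    using mult[of "(a, 0)" "(0, b)"] by (simp add: fst snd)
qed

lemma T_Q_eqI:
  assumes "t \<in> T_Q" "t' \<in> T_Q" "t (X \<alpha>1) = t' (X \<alpha>1)" "t (X \<alpha>2) = t' (X \<alpha>2)"
  shows "t = t'"
proof -
  have "t (X \<nu>) = t' (X \<nu>)" for \<nu>
    using assms by (cases \<nu>) (simp add: T_Q_X)
  then have "t f = t' f" for f
    unfolding T_Q_eq_lin_ext[OF assms(1), of f] T_Q_eq_lin_ext[OF assms(2), of f] by simp
  then show ?thesis ..
qed

lemma act_X: "act w t (X \<nu>) = t (X (inv_into UNIV w \<nu>))"
  by (simp add: act_def)

lemma act_in_T_Q:
  assumes "w \<in> W0" "t \<in> T_Q"
  shows "act w t \<in> T_Q"
proof -
  have inv_add: "inv_into UNIV w (\<nu> + \<mu>) = inv_into UNIV w \<nu> + inv_into UNIV w \<mu>" for \<nu> \<mu>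
    using W0_bij[OF assms(1)] W0_add[OF assms(1)]
    by (metis bij_inv_eq_iff)
  have "inv_into UNIV w 0 = 0"
    using inv_add[of 0 0] by simp
  then show ?thesis
    unfolding act_def using assms(2)
    by (intro lin_ext_in_T_Q) (simp_all add: inv_add X_add X_zero T_Q_def)
qed

end

theory Submission
  imports Defs
begin

text \<open>
  A weight is determined by the pair \<open>(z, w)\<close> of its values at the simple roots, and on such pairs
  the simple reflections act by \<open>s\<^sub>1 : (z, w) \<mapsto> (z\<inverse>, z\<^sup>2w)\<close> and \<open>s\<^sub>2 : (z, w) \<mapsto> (zw, w\<inverse>)\<close>
  (\<open>act_s1_weight\<close>, \<open>act_s2_weight\<close>). If some root takes a value in \<open>{1, q\<^sup>2, q\<^sup>-\<^sup>2}\<close>, at most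
  one reflection moves that root to a simple one, since \<open>s\<^sub>2\<alpha>\<^sub>1 = \<alpha>\<^sub>1 + \<alpha>\<^sub>2\<close> and \<open>s\<^sub>1\<alpha>\<^sub>2 = 2\<alpha>\<^sub>1 + \<alpha>\<^sub>2\<close>, and the
  longest element \<open>-1\<close> of \<open>W\<^sub>0\<close> exchanges \<open>q\<^sup>-\<^sup>2\<close> and \<open>q\<^sup>2\<close>. So the weight may be taken in one of the
  four families \<open>(1, z)\<close>, \<open>(z, 1)\<close>, \<open>(q\<^sup>2, z)\<close>, \<open>(z, q\<^sup>2)\<close>.

  Each family is listed except for finitely many values of \<open>z\<close>. What remains is to see that at an
  exceptional value the weight is conjugate to one of the eight isolated weights. These
  computations are the lemmas \<open>orbits_short_1\<close>, \<open>orbits_long_1\<close>, \<open>orbits_short_q2\<close> and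
  \<open>orbits_long_q2\<close>.
\<close>

section \<open>The Weyl group acting on pairs of coordinates\<close>

lemma weight_at:
  "weight z w (X (a, b)) = z powi a * w powi b"
  by (simp add: weight_def)

lemma T_Q_eq_weight:
  assumes "t \<in> T_Q"
  shows "t = weight (t (X \<alpha>1)) (t (X \<alpha>2))"
  using assms by (intro T_Q_eqI weight_in_T_Q) (simp_all add: weight_X T_Q_X)

lemma simple_reflections_in_W0: "s1 \<in> W0" "s2 \<in> W0"
  by (auto simp: W0_def intro: generate.incl)

lemma id_in_W0: "id \<in> W0"
proof -
  have "\<one>\<^bsub>BijGroup UNIV\<^esub> = (id :: root_lattice \<Rightarrow> root_lattice)"
    by (simp add: BijGroup_def fun_eq_iff)
  then show ?thesis
    using generate.one[of "BijGroup UNIV" "{s1, s2}"] by (simp add: W0_def)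
qed

lemma comp_in_W0:
  assumes "v \<in> W0" "w \<in> W0"
  shows "v \<circ> w \<in> W0"
  using generate.eng[of v "BijGroup UNIV" "{s1, s2}" w] assms
    mult_BijGroup_UNIV[OF assms[THEN W0_in_BijGroup]]
  by (simp add: W0_def)

lemma act_id:
  assumes "t \<in> T_Q"
  shows "act id t = t"
  using assms by (intro T_Q_eqI act_in_T_Q id_in_W0) (simp_all add: act_X inv_id)

lemma act_comp:
  assumes "v \<in> W0" "w \<in> W0"
  shows "act (v \<circ> w) t = act v (act w t)"
proof -
  have "inv_into UNIV (v \<circ> w) \<nu> = inv_into UNIV w (inv_into UNIV v \<nu>)" for \<nu>
    using o_inv_distrib[OF assms[THEN W0_bij]] by simp
  then show ?thesis
    by (simp add: act_def)
qed

lemma W0_orbit_refl: "t \<in> T_Q \<Longrightarrow> t \<in> W0_orbit t"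
  unfolding W0_orbit_def using id_in_W0 by (auto intro!: exI[of _ id] simp: act_id)

lemma act_in_W0_orbit: "w \<in> W0 \<Longrightarrow> t \<in> W0_orbit t0 \<Longrightarrow> act w t \<in> W0_orbit t0"
  unfolding W0_orbit_def by (auto simp flip: act_comp intro: comp_in_W0)

lemma act_s1_weight:
  assumes "z \<noteq> 0" "w \<noteq> 0"
  shows "act s1 (weight z w) = weight (inverse z) (z\<^sup>2 * w)"
proof (rule T_Q_eqI)
  have "inv_into UNIV s1 = s1"
    by (rule inv_equality) simp_all
  then show "act s1 (weight z w) (X \<alpha>1) = weight (inverse z) (z\<^sup>2 * w) (X \<alpha>1)"
    and "act s1 (weight z w) (X \<alpha>2) = weight (inverse z) (z\<^sup>2 * w) (X \<alpha>2)"
    by (simp_all add: act_X weight_X) (simp_all add: \<alpha>1_def \<alpha>2_def s1_apply weight_at)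
qed (use assms in \<open>auto intro!: act_in_T_Q weight_in_T_Q simple_reflections_in_W0\<close>)

lemma act_s2_weight:
  assumes "z \<noteq> 0" "w \<noteq> 0"
  shows "act s2 (weight z w) = weight (z * w) (inverse w)"
proof (rule T_Q_eqI)
  have "inv_into UNIV s2 = s2"
    by (rule inv_equality) simp_all
  then show "act s2 (weight z w) (X \<alpha>1) = weight (z * w) (inverse w) (X \<alpha>1)"
    and "act s2 (weight z w) (X \<alpha>2) = weight (z * w) (inverse w) (X \<alpha>2)"
    by (simp_all add: act_X weight_X) (simp_all add: \<alpha>1_def \<alpha>2_def s2_apply weight_at)
qed (use assms in \<open>auto intro!: act_in_T_Q weight_in_T_Q simple_reflections_in_W0\<close>)


section \<open>Conjugates of the listed weights\<close>

definition isolated_weights :: "complex \<Rightarrow> (group_algebra \<Rightarrow> complex) set" where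
  "isolated_weights q = {weight 1 1, weight (-1) 1, weight 1 (q\<^sup>2), weight (q\<^sup>2) 1, weight q 1,
     weight (-q) 1, weight (q\<^sup>2) (q\<^sup>2), weight (-1) (q\<^sup>2)}"

definition generic_weights :: "complex \<Rightarrow> (group_algebra \<Rightarrow> complex) set" where
  "generic_weights q =
     {weight 1 z | z. z \<noteq> 0 \<and> z \<notin> {1, q\<^sup>2, q powi (-2)}}
   \<union> {weight z 1 | z. z \<noteq> 0 \<and>
        z \<notin> {1, -1, q\<^sup>2, q powi (-2), q, -q, q powi (-1), - (q powi (-1))}}
   \<union> {weight (q\<^sup>2) z | z. z \<noteq> 0 \<and> z \<notin> {1, q\<^sup>2, q powi (-2), q powi (-4), q powi (-6)}}
   \<union> {weight z (q\<^sup>2) | z. z \<noteq> 0 \<and>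
        z \<notin> {1, -1, q\<^sup>2, q powi (-2), - (q powi (-2)), q powi (-4),
           q powi (-1), - (q powi (-1))}}"

definition listed_orbits :: "complex \<Rightarrow> (group_algebra \<Rightarrow> complex) set" where
  "listed_orbits q = (\<Union>t0 \<in> isolated_weights q \<union> generic_weights q. W0_orbit t0)"

lemma isolated_in_listed_orbits:
  assumes "q \<noteq> 0"
  shows "weight 1 1 \<in> listed_orbits q" "weight (-1) 1 \<in> listed_orbits q"
    "weight 1 (q\<^sup>2) \<in> listed_orbits q" "weight (q\<^sup>2) 1 \<in> listed_orbits q"
    "weight q 1 \<in> listed_orbits q" "weight (-q) 1 \<in> listed_orbits q"
    "weight (q\<^sup>2) (q\<^sup>2) \<in> listed_orbits q" "weight (-1) (q\<^sup>2) \<in> listed_orbits q"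
proof -
  have "isolated_weights q \<subseteq> T_Q"
    using assms by (simp add: isolated_weights_def weight_in_T_Q)
  then have "isolated_weights q \<subseteq> listed_orbits q"
    unfolding listed_orbits_def using W0_orbit_refl by blast
  then show "weight 1 1 \<in> listed_orbits q" "weight (-1) 1 \<in> listed_orbits q"
    "weight 1 (q\<^sup>2) \<in> listed_orbits q" "weight (q\<^sup>2) 1 \<in> listed_orbits q"
    "weight q 1 \<in> listed_orbits q" "weight (-q) 1 \<in> listed_orbits q"
    "weight (q\<^sup>2) (q\<^sup>2) \<in> listed_orbits q" "weight (-1) (q\<^sup>2) \<in> listed_orbits q"
    by (simp_all add: isolated_weights_def)
qed

lemma generic_in_listed_orbits:
  assumes "weight z w \<in> generic_weights q" "z \<noteq> 0" "w \<noteq> 0"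
  shows "weight z w \<in> listed_orbits q"
  unfolding listed_orbits_def using assms
  by (intro UN_I[of "weight z w"] W0_orbit_refl weight_in_T_Q) simp_all

lemma act_in_listed_orbits:
  "w \<in> W0 \<Longrightarrow> t \<in> listed_orbits q \<Longrightarrow> act w t \<in> listed_orbits q"
  unfolding listed_orbits_def by (blast intro: act_in_W0_orbit)

lemma listed_orbits_s1:
  assumes "z \<noteq> 0" "w \<noteq> 0"
  shows "weight (inverse z) (z\<^sup>2 * w) \<in> listed_orbits q \<longleftrightarrow> weight z w \<in> listed_orbits q"
  using act_in_listed_orbits[OF simple_reflections_in_W0(1), of "weight z w" q]
    act_in_listed_orbits[OF simple_reflections_in_W0(1), of "weight (inverse z) (z\<^sup>2 * w)" q] assms
  by (auto simp: act_s1_weight power_inverse simp flip: mult.assoc)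

lemma listed_orbits_s2:
  assumes "z \<noteq> 0" "w \<noteq> 0"
  shows "weight (z * w) (inverse w) \<in> listed_orbits q \<longleftrightarrow> weight z w \<in> listed_orbits q"
  using act_in_listed_orbits[OF simple_reflections_in_W0(2), of "weight z w" q]
    act_in_listed_orbits[OF simple_reflections_in_W0(2), of "weight (z * w) (inverse w)" q] assms
  by (auto simp: act_s2_weight mult.assoc)

text \<open>
  The longest element \<open>s\<^sub>1s\<^sub>2s\<^sub>1s\<^sub>2\<close> of \<open>W\<^sub>0\<close> is \<open>-1\<close>, so it inverts both coordinates.
\<close>

lemma listed_orbits_inverse:
  assumes "z \<noteq> 0" "w \<noteq> 0"
  shows "weight (inverse z) (inverse w) \<in> listed_orbits q \<longleftrightarrow> weight z w \<in> listed_orbits q"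
proof -
  have "weight z w \<in> listed_orbits q \<longleftrightarrow> weight (z * w) (inverse w) \<in> listed_orbits q"
    using assms by (simp add: listed_orbits_s2)
  also have "\<dots> \<longleftrightarrow> weight (inverse (z * w)) (z\<^sup>2 * w) \<in> listed_orbits q"
    using assms listed_orbits_s1[of "z * w" "inverse w" q] by (simp add: field_simps power2_eq_square)
  also have "\<dots> \<longleftrightarrow> weight z (inverse (z\<^sup>2 * w)) \<in> listed_orbits q"
    using assms listed_orbits_s2[of "inverse (z * w)" "z\<^sup>2 * w" q]
    by (simp add: field_simps power2_eq_square)
  also have "\<dots> \<longleftrightarrow> weight (inverse z) (inverse w) \<in> listed_orbits q"
    using assms listed_orbits_s1[of z "inverse (z\<^sup>2 * w)" q] by (simp add: field_simps)
  finally show ?thesis by simp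
qed


section \<open>Weights with a prescribed value at a simple root\<close>

lemma powi_neg_numerals:
  fixes q :: "'a::division_ring"
  shows "q powi (-1) = inverse q" "q powi (-2) = inverse (q\<^sup>2)"
    "q powi (-4) = inverse (q\<^sup>2 * q\<^sup>2)" "q powi (-6) = inverse (q\<^sup>2 * q\<^sup>2 * q\<^sup>2)"
  by (simp_all add: power_int_def power_inverse flip: power_add)

text \<open>
  The only exceptional value not itself listed is \<open>q\<^sup>-\<^sup>2\<close>, and \<open>(1, q\<^sup>-\<^sup>2)\<close> is inverse to \<open>(1, q\<^sup>2)\<close>.
\<close>

lemma orbits_short_1:
  assumes "q \<noteq> 0" "w \<noteq> 0"
  shows "weight 1 w \<in> listed_orbits q"
proof (cases "w \<in> {1, q\<^sup>2, q powi (-2)}")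
  case True
  have "weight 1 (inverse (q\<^sup>2)) \<in> listed_orbits q"
    using listed_orbits_inverse[of 1 "q\<^sup>2" q] isolated_in_listed_orbits assms by simp
  with True show ?thesis
    using isolated_in_listed_orbits[OF assms(1)] by (auto simp: powi_neg_numerals)
next
  case False
  with assms show ?thesis
    by (intro generic_in_listed_orbits) (auto simp: generic_weights_def)
qed

text \<open>
  The element \<open>-1\<close> conjugates \<open>(z, 1)\<close> to \<open>(z\<inverse>, 1)\<close>, and every exceptional \<open>z\<close> belongs to an isolated
  weight or is the inverse of one that does.
\<close>

lemma orbits_long_1:
  assumes "q \<noteq> 0" "z \<noteq> 0"
  shows "weight z 1 \<in> listed_orbits q"
proof (cases "z \<in> {1, -1, q\<^sup>2, q powi (-2), q, -q, q powi (-1), - (q powi (-1))}")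
  case True
  have "weight (inverse x) 1 \<in> listed_orbits q" if "x \<in> {q\<^sup>2, q, -q}" for x
    using that listed_orbits_inverse[of x 1 q] isolated_in_listed_orbits[OF assms(1)] assms
    by auto
  from this[of "q\<^sup>2"] this[of q] this[of "-q"] True show ?thesis
    using isolated_in_listed_orbits[OF assms(1)] by (auto simp: powi_neg_numerals)
next
  case False
  with assms show ?thesis
    by (intro generic_in_listed_orbits) (auto simp: generic_weights_def)
qed

text \<open>
  The element \<open>-s\<^sub>1\<close> preserves the family \<open>(q\<^sup>2, w)\<close> and acts on it by \<open>w \<mapsto> q\<^sup>-\<^sup>4w\<inverse>\<close>. This sends
  the exceptional values \<open>q\<^sup>-\<^sup>4\<close> and \<open>q\<^sup>-\<^sup>6\<close> to \<open>1\<close> and \<open>q\<^sup>2\<close>, which give isolated weights. The value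
  \<open>q\<^sup>-\<^sup>2\<close> is a fixed point, but \<open>(q\<^sup>2, q\<^sup>-\<^sup>2) = s\<^sub>2(1, q\<^sup>2)\<close>.
\<close>

lemma orbits_short_q2:
  assumes "q \<noteq> 0" "w \<noteq> 0"
  shows "weight (q\<^sup>2) w \<in> listed_orbits q"
proof (cases "w \<in> {1, q\<^sup>2, q powi (-2), q powi (-4), q powi (-6)}")
  case True
  define p where "p = q\<^sup>2"
  note isolated = isolated_in_listed_orbits[OF assms(1), folded p_def]
  have p: "p \<noteq> 0" using assms by (simp add: p_def)
  have m2: "weight p (inverse p) \<in> listed_orbits q"
    using listed_orbits_s2[of 1 p q] isolated p by simp
  have flip: "weight p w \<in> listed_orbits q"
    if "weight p w' \<in> listed_orbits q" "p\<^sup>2 * w * w' = 1" for w w'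
  proof -
    have "w \<noteq> 0" "w' = inverse (p\<^sup>2 * w)"
      using that inverse_unique[OF that(2)] by auto
    then show ?thesis
      using that(1) listed_orbits_s1[of p w q] listed_orbits_inverse[of "inverse p" "p\<^sup>2 * w" q] p
      by simp
  qed
  have m4: "weight p (inverse (p * p)) \<in> listed_orbits q"
    using p by (intro flip[OF isolated(4)]) (simp add: field_simps power2_eq_square)
  have m6: "weight p (inverse (p * p * p)) \<in> listed_orbits q"
    using p by (intro flip[OF isolated(7)]) (simp add: field_simps power2_eq_square)
  show ?thesis
    using True isolated m2 m4 m6 unfolding powi_neg_numerals p_def by (elim insertE) simp_all
next
  case False
  with assms show ?thesis
    by (intro generic_in_listed_orbits) (auto simp: generic_weights_def)
qed

text \<open>
  The element \<open>-s\<^sub>2\<close> preserves the family \<open>(z, q\<^sup>2)\<close> and acts on it by \<open>z \<mapsto> q\<^sup>-\<^sup>2z\<inverse>\<close>. This sends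
  the exceptional values \<open>q\<^sup>-\<^sup>2\<close>, \<open>-q\<^sup>-\<^sup>2\<close> and \<open>q\<^sup>-\<^sup>4\<close> to \<open>1\<close>, \<open>-1\<close> and \<open>q\<^sup>2\<close>. The fixed points
  \<open>\<plusminus>q\<^sup>-\<^sup>1\<close> come from the family \<open>(z, 1)\<close>, since \<open>(\<plusminus>q\<^sup>-\<^sup>1, q\<^sup>2) = s\<^sub>1(\<plusminus>q, 1)\<close>.
\<close>

lemma orbits_long_q2:
  assumes "q \<noteq> 0" "z \<noteq> 0"
  shows "weight z (q\<^sup>2) \<in> listed_orbits q"
proof (cases "z \<in> {1, -1, q\<^sup>2, q powi (-2), - (q powi (-2)), q powi (-4),
                 q powi (-1), - (q powi (-1))}")
  case True
  define p where "p = q\<^sup>2"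
  note isolated = isolated_in_listed_orbits[OF assms(1), folded p_def]
  have p: "p \<noteq> 0" using assms by (simp add: p_def)
  have flip: "weight z p \<in> listed_orbits q"
    if "weight z' p \<in> listed_orbits q" "z * p * z' = 1" for z z'
  proof -
    have "z \<noteq> 0" "z' = inverse (z * p)"
      using that inverse_unique[OF that(2)] by auto
    then show ?thesis
      using that(1) listed_orbits_s2[of z p q] listed_orbits_inverse[of "z * p" "inverse p" q] p
      by simp
  qed
  have m2: "weight (inverse p) p \<in> listed_orbits q"
    using p by (intro flip[OF isolated(3)]) (simp add: field_simps power2_eq_square)
  have m2': "weight (- inverse p) p \<in> listed_orbits q"
    using p by (intro flip[OF isolated(8)]) (simp add: field_simps power2_eq_square)
  have m4: "weight (inverse (p * p)) p \<in> listed_orbits q"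
    using p by (intro flip[OF isolated(7)]) (simp add: field_simps power2_eq_square)
  have m1: "weight (inverse x) p \<in> listed_orbits q" if "x \<in> {q, -q}" for x
    using that listed_orbits_s1[of x 1 q] isolated assms by (auto simp: p_def)
  show ?thesis
    using True isolated m2 m2' m4 m1[of q] m1[of "-q"] unfolding powi_neg_numerals p_def by (elim insertE) simp_all
next
  case False
  with assms show ?thesis
    by (intro generic_in_listed_orbits) (auto simp: generic_weights_def)
qed

lemma listed_orbits_if_simple_root:
  assumes "q \<noteq> 0" "z \<noteq> 0" "w \<noteq> 0"
    and "z \<in> {1, q\<^sup>2, inverse (q\<^sup>2)} \<or> w \<in> {1, q\<^sup>2, inverse (q\<^sup>2)}"
  shows "weight z w \<in> listed_orbits q"
proof -
  have "weight (inverse (q\<^sup>2)) w \<in> listed_orbits q"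
    using listed_orbits_inverse[of "q\<^sup>2" "inverse w" q] orbits_short_q2[of q "inverse w"] assms by simp
  moreover have "weight z (inverse (q\<^sup>2)) \<in> listed_orbits q"
    using listed_orbits_inverse[of "inverse z" "q\<^sup>2" q] orbits_long_q2[of q "inverse z"] assms by simp
  ultimately show ?thesis
    using assms orbits_short_1 orbits_long_1 orbits_short_q2 orbits_long_q2 by auto
qed

theorem proposition15:
  fixes q :: complex and t :: "group_algebra \<Rightarrow> complex"
  assumes "q \<noteq> 0"
    and "\<And>l::nat. l \<le> 4 \<Longrightarrow> \<not> primitive_root_of_unity l (q\<^sup>2)"
    and "t \<in> T_Q"
    and "P_roots q t \<union> Z_roots t \<noteq> {}"
  shows "(\<exists>t0 \<in> {weight 1 1, weight (-1) 1, weight 1 (q\<^sup>2), weight (q\<^sup>2) 1, weight q 1,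
             weight (-q) 1, weight (q\<^sup>2) (q\<^sup>2), weight (-1) (q\<^sup>2)}. t \<in> W0_orbit t0)
       \<or> (\<exists>z. z \<noteq> 0 \<and> z \<notin> {1, q\<^sup>2, q powi (-2)} \<and> t \<in> W0_orbit (weight 1 z))
       \<or> (\<exists>z. z \<noteq> 0 \<and> z \<notin> {1, -1, q\<^sup>2, q powi (-2), q, -q, q powi (-1), - (q powi (-1))}
            \<and> t \<in> W0_orbit (weight z 1))
       \<or> (\<exists>z. z \<noteq> 0 \<and> z \<notin> {1, q\<^sup>2, q powi (-2), q powi (-4), q powi (-6)}
            \<and> t \<in> W0_orbit (weight (q\<^sup>2) z))
       \<or> (\<exists>z. z \<noteq> 0 \<and> z \<notin> {1, -1, q\<^sup>2, q powi (-2), - (q powi (-2)), q powi (-4),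
                 q powi (-1), - (q powi (-1))}
            \<and> t \<in> W0_orbit (weight z (q\<^sup>2)))"
proof -
  define z w where "z = t (X \<alpha>1)" and "w = t (X \<alpha>2)"
  define V where "V = {1, q\<^sup>2, inverse (q\<^sup>2)}"
  have nz: "z \<noteq> 0" "w \<noteq> 0"
    using T_Q_X[OF assms(3)] by (simp_all add: z_def w_def)
  have t: "t = weight z w"
    unfolding z_def w_def by (rule T_Q_eq_weight[OF assms(3)])
  obtain \<alpha> where "\<alpha> \<in> pos_roots" "t (X \<alpha>) \<in> V"
    using assms(4) by (auto simp: P_roots_def Z_roots_def V_def powi_neg_numerals)
  then have "z \<in> V \<or> w \<in> V \<or> z * w \<in> V \<or> z\<^sup>2 * w \<in> V"
    by (auto simp: pos_roots_def t \<alpha>1_def \<alpha>2_def weight_at)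
  then have "t \<in> listed_orbits q"
    using listed_orbits_if_simple_root[OF assms(1), of z w]
      listed_orbits_if_simple_root[OF assms(1), of "z * w" "inverse w"]
      listed_orbits_if_simple_root[OF assms(1), of "inverse z" "z\<^sup>2 * w"]
      listed_orbits_s1[OF nz, of q] listed_orbits_s2[OF nz, of q] nz
    unfolding t V_def by simp blast
  then show ?thesis
    unfolding listed_orbits_def isolated_weights_def generic_weights_def UN_Un
    by (elim UnE) blast+
qed

end
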